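(* Let $H\le G\le S_n$ be groups, let $m\in\mathbb{Z}[X_1,\dots,X_n]$ be a monomial, and let $S=\mathrm{Stab}_G(m)$ be its stabiliser in $G$. Let $\{g_i\mid 1\le i\le r\}$ be a set of representatives of the double cosets $S\setminus G/H$, i.e. $G=\bigcup_{i=1}^r Sg_iH$ and $Sg_iH=Sg_jH$ if and only if $i=j$. Then $\{m^{g_i}\mid 1\le i\le r\}$ generate linearly independent $H$-invariants; that is, the polynomials $$\sum (m^{g_i})^H:=\sum_{p\in\{(m^{g_i})^h\,\mid\, h\in H\}}p\qquad(1\le i\le r)$$ are $H$-invariant and linearly independent over $\mathbb{Q}$.
   Context: $S_n$ acts on $\mathbb{Z}[X_1,\dots,X_n]$ by $X_i\mapsto X_{\sigma(i)}$; the image of a polynomial $F$ is written $F^\sigma$. Products of permutations are read from left to right, so that $F^{\sigma\tau}=(F^\sigma)^\tau$. $\mathrm{Stab}_G(F)=\{\sigma\in G\mid F^\sigma=F\}$. A polynomial $F$ is $H$-invariant if $F^h=F$ for all $h\in H$. The $H$-invariant generated by a polynomial is the sum over its $H$-orbit (each element of the orbit taken once). *)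

theory Defs
  imports
    Complex_Main
    "HOL-Library.Poly_Mapping"
    "HOL-Algebra.Sym_Groups"
begin

text \<open>
  Polynomials over \<open>'a\<close> in the indeterminates \<open>X\<^sub>i\<close>, as finitely supported maps from exponent
  vectors to coefficients with the convolution product of \<^theory>\<open>HOL-Library.Poly_Mapping\<close>.
  The ring in \<open>X\<^sub>1, \<dots>, X\<^sub>n\<close> is the subring of those involving only indices in \<open>{1..n}\<close>.
\<close>

type_synonym 'a mpoly = "(nat \<Rightarrow>\<^sub>0 nat) \<Rightarrow>\<^sub>0 'a"

definition X :: "nat \<Rightarrow> 'a::comm_semiring_1 mpoly" where
  "X i = Poly_Mapping.single (Poly_Mapping.single i 1) 1"

definition is_monomial :: "nat \<Rightarrow> 'a::comm_semiring_1 mpoly \<Rightarrow> bool" where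
  "is_monomial n m \<longleftrightarrow> (\<exists>e :: nat \<Rightarrow> nat. m = (\<Prod>i\<in>{1..n}. X i ^ e i))"

text \<open>
  \<open>act \<sigma> F\<close> is \<open>F\<^sup>\<sigma>\<close>, the substitution of \<open>X\<^bsub>\<sigma> i\<^esub>\<close> for \<open>X\<^sub>i\<close>. Constants are embedded by
  \<open>single 0\<close>.
\<close>

definition act :: "(nat \<Rightarrow> nat) \<Rightarrow> 'a::comm_semiring_1 mpoly \<Rightarrow> 'a mpoly" where
  "act \<sigma> F = (\<Sum>a\<in>Poly_Mapping.keys F.
      Poly_Mapping.single 0 (Poly_Mapping.lookup F a) *
      (\<Prod>i\<in>Poly_Mapping.keys a. X (\<sigma> i) ^ Poly_Mapping.lookup a i))"

text \<open>
  \<open>S\<^sub>n\<close> with products read from left to right: \<open>\<sigma>\<tau>\<close> first applies \<open>\<sigma>\<close>, then \<open>\<tau>\<close>. The library's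
  \<^const>\<open>sym_group\<close> uses the opposite convention.
\<close>

definition Sym :: "nat \<Rightarrow> (nat \<Rightarrow> nat) monoid" where
  "Sym n = (sym_group n)\<lparr>mult := (\<lambda>\<sigma> \<tau>. \<tau> \<circ> \<sigma>)\<rparr>"

definition Stab :: "(nat \<Rightarrow> nat) set \<Rightarrow> 'a::comm_semiring_1 mpoly \<Rightarrow> (nat \<Rightarrow> nat) set" where
  "Stab G F = {\<sigma> \<in> G. act \<sigma> F = F}"

definition invariant :: "(nat \<Rightarrow> nat) set \<Rightarrow> 'a::comm_semiring_1 mpoly \<Rightarrow> bool" where
  "invariant H F \<longleftrightarrow> (\<forall>h\<in>H. act h F = F)"

definition orbit_sum :: "(nat \<Rightarrow> nat) set \<Rightarrow> 'a::comm_semiring_1 mpoly \<Rightarrow> 'a mpoly" where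
  "orbit_sum H F = (\<Sum>p\<in>{act h F |h. h \<in> H}. p)"

definition double_coset :: "('a, 'b) monoid_scheme \<Rightarrow> 'a set \<Rightarrow> 'a \<Rightarrow> 'a set \<Rightarrow> 'a set" where
  "double_coset K S g H = (S #>\<^bsub>K\<^esub> g) <#>\<^bsub>K\<^esub> H"

text \<open>
  Rational polynomials as a rational vector space, so that \<open>rat_mpoly.independent\<close> is linear
  independence over the rationals.
\<close>

abbreviation to_rat_mpoly :: "int mpoly \<Rightarrow> rat mpoly" where
  "to_rat_mpoly \<equiv> Poly_Mapping.map rat_of_int"

abbreviation scale_mpoly :: "rat \<Rightarrow> rat mpoly \<Rightarrow> rat mpoly" where
  "scale_mpoly c \<equiv> Poly_Mapping.map ((*) c)"

interpretation rat_mpoly: vector_space scale_mpoly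
  by unfold_locales
    (simp_all add: mult_map_scale_conv_mult distrib_left single_add distrib_right
      mult_single flip: mult.assoc)

lemma group_Sym: "group (Sym n)"
proof (rule groupI)
  fix p assume "p \<in> carrier (Sym n)"
  then have "p permutes {1..n}" by (simp add: Sym_def sym_group_def)
  then show "\<exists>q\<in>carrier (Sym n). q \<otimes>\<^bsub>Sym n\<^esub> p = \<one>\<^bsub>Sym n\<^esub>"
    by (intro bexI[of _ "inv' p"])
       (auto simp: Sym_def sym_group_def permutes_inv permutes_inv_o)
qed (auto simp: Sym_def sym_group_def permutes_compose permutes_id comp_assoc)

lemma act_superset:
  assumes "finite A" "Poly_Mapping.keys F \<subseteq> A"
  shows "act \<sigma> F = (\<Sum>a\<in>A. Poly_Mapping.single 0 (Poly_Mapping.lookup F a) *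
      (\<Prod>i\<in>Poly_Mapping.keys a. X (\<sigma> i) ^ Poly_Mapping.lookup a i))"
  unfolding act_def using assms by (intro sum.mono_neutral_left) (auto simp: in_keys_iff)

lemma act_add: "act \<sigma> (F + G) = act \<sigma> F + act \<sigma> G"
proof -
  let ?A = "Poly_Mapping.keys F \<union> Poly_Mapping.keys G"
  have "Poly_Mapping.keys (F + G) \<subseteq> ?A" by (rule Poly_Mapping.keys_add)
  then show ?thesis
    by (simp add: act_superset[of ?A] lookup_add single_add distrib_right sum.distrib)
qed

lemma act_zero [simp]: "act \<sigma> 0 = 0"
  by (simp add: act_def)

lemma act_single: "act \<sigma> (Poly_Mapping.single a c) = Poly_Mapping.single 0 c *
      (\<Prod>i\<in>Poly_Mapping.keys a. X (\<sigma> i) ^ Poly_Mapping.lookup a i)"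
  by (subst act_superset[of "{a}"]) (auto split: if_splits)

lemma act_X [simp]: "act \<sigma> (X i) = X (\<sigma> i)"
  by (simp add: X_def[of i] act_single)

lemma act_one [simp]: "act \<sigma> 1 = 1"
  using act_single[of \<sigma> 0 1] by (simp add: single_one)

lemma prod_X_superset:
  assumes "finite A" "Poly_Mapping.keys a \<subseteq> A"
  shows "(\<Prod>i\<in>Poly_Mapping.keys a. X (\<sigma> i) ^ Poly_Mapping.lookup a i) =
    (\<Prod>i\<in>A. X (\<sigma> i) ^ Poly_Mapping.lookup a i)"
  using assms by (intro prod.mono_neutral_left) (auto simp: in_keys_iff)

lemma act_single_mult:
  "act \<sigma> (Poly_Mapping.single a c * Poly_Mapping.single b d) =
   act \<sigma> (Poly_Mapping.single a c) * act \<sigma> (Poly_Mapping.single b d)"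
proof -
  let ?A = "Poly_Mapping.keys a \<union> Poly_Mapping.keys b"
  have "Poly_Mapping.keys (a + b) \<subseteq> ?A" by (rule Poly_Mapping.keys_add)
  then have "act \<sigma> (Poly_Mapping.single a c * Poly_Mapping.single b d) =
    Poly_Mapping.single 0 (c * d) *
    ((\<Prod>i\<in>?A. X (\<sigma> i) ^ Poly_Mapping.lookup a i) * (\<Prod>i\<in>?A. X (\<sigma> i) ^ Poly_Mapping.lookup b i))"
    unfolding mult_single act_single
    by (subst prod_X_superset[of ?A "a + b"]) (simp_all add: lookup_add power_add prod.distrib)
  also have "Poly_Mapping.single 0 (c * d) = Poly_Mapping.single 0 c * Poly_Mapping.single 0 d"
    by (simp add: mult_single)
  finally show ?thesis
    by (simp add: act_single prod_X_superset[of ?A a] prod_X_superset[of ?A b] mult_ac)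
qed

lemma mpoly_induct [case_names zero add]:
  fixes F :: "'a::comm_semiring_1 mpoly"
  assumes "P 0" "\<And>a c F. P F \<Longrightarrow> P (Poly_Mapping.single a c + F)"
  shows "P F"
proof -
  have "P (\<Sum>a\<in>A. Poly_Mapping.single a (Poly_Mapping.lookup F a))" if "finite A" for A
    using that by induction (auto intro: assms)
  moreover have "(\<Sum>a\<in>Poly_Mapping.keys F. Poly_Mapping.single a (Poly_Mapping.lookup F a)) = F"
    by (rule poly_mapping_eqI) (auto simp: lookup_sum lookup_single when_def in_keys_iff)
  ultimately show ?thesis
    by (metis finite_keys)
qed

lemma act_mult: "act \<sigma> (F * G) = act \<sigma> F * act \<sigma> G"
proof (induction F rule: mpoly_induct)
  case (add a c F)
  have "act \<sigma> (Poly_Mapping.single a c * G) = act \<sigma> (Poly_Mapping.single a c) * act \<sigma> G"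
    by (induction G rule: mpoly_induct) (simp_all add: act_add act_single_mult distrib_left)
  with add show ?case by (simp add: act_add distrib_right)
qed simp

lemma act_power: "act \<sigma> (F ^ k) = act \<sigma> F ^ k"
  by (induction k) (simp_all add: act_mult)

lemma act_prod: "act \<sigma> (\<Prod>i\<in>A. f i) = (\<Prod>i\<in>A. act \<sigma> (f i))"
  by (induction A rule: infinite_finite_induct) (simp_all add: act_mult)

lemma act_act: "act (\<sigma> \<otimes>\<^bsub>Sym n\<^esub> \<tau>) F = act \<tau> (act \<sigma> F)"
  by (induction F rule: mpoly_induct)
    (simp_all add: Sym_def act_add act_mult act_single act_prod act_power)

end

theory Submission
  imports Defs
begin

text \<open>
  Every \<open>m\<^sup>\<sigma>\<close> is a monomial with coefficient 1, and \<open>m\<^sup>\<sigma> = m\<^sup>\<tau>\<close> for \<open>\<sigma>, \<tau> \<in> G\<close> holds iff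
  \<open>\<sigma>\<tau>\<^sup>-\<^sup>1 \<in> S\<close>. So the \<open>H\<close>-orbits of \<open>m\<^bsup>g\<^sub>i\<^esup>\<close> and \<open>m\<^bsup>g\<^sub>j\<^esup>\<close> meet only if \<open>Sg\<^sub>iH\<close> and \<open>Sg\<^sub>jH\<close>
  meet, that is, only if \<open>i = j\<close>. Hence the coefficient of \<open>m\<^bsup>g\<^sub>i\<^esup>\<close> in the \<open>j\<close>-th orbit sum is
  1 for \<open>i = j\<close> and 0 otherwise, which gives linear independence.
\<close>

lemma X_power: "X i ^ k = Poly_Mapping.single (Poly_Mapping.single i k) 1"
  by (induction k) (simp_all add: X_def mult_single single_one flip: single_add)

lemma prod_single_one:
  "(\<Prod>i\<in>A. Poly_Mapping.single (f i) (1 :: 'a::comm_semiring_1)) =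
    Poly_Mapping.single (\<Sum>i\<in>A. f i) 1"
  by (induction A rule: infinite_finite_induct) (simp_all add: mult_single single_one)

lemma sum_single_lookup:
  "(\<Sum>i\<in>Poly_Mapping.keys a. Poly_Mapping.single i (Poly_Mapping.lookup a i)) = a"
  by (rule poly_mapping_eqI) (auto simp: lookup_sum lookup_single when_def in_keys_iff)

lemma act_id: "act id F = F"
  by (induction F rule: mpoly_induct)
    (simp_all add: act_add act_single X_power prod_single_one sum_single_lookup mult_single)

lemma act_one_Sym: "act \<one>\<^bsub>Sym n\<^esub> F = F"
  using act_id by (simp add: Sym_def sym_group_def)

lemma act_sum: "act \<sigma> (\<Sum>i\<in>A. f i) = (\<Sum>i\<in>A. act \<sigma> (f i))"
  by (induction A rule: infinite_finite_induct) (simp_all add: act_add)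

text \<open>Every factor of the image is a power of an indeterminate, so no coefficient other than 1
  can arise, whatever the map \<open>\<sigma>\<close>. Thus all orbits considered below consist of
  coefficient-1 monomials.\<close>

lemma act_single_one:
  "\<exists>b. act \<sigma> (Poly_Mapping.single a (1 :: 'a::comm_semiring_1)) = Poly_Mapping.single b 1"
  by (auto simp: act_single X_power prod_single_one mult_single)

lemma is_monomialD:
  assumes "is_monomial n m"
  shows "\<exists>a. m = Poly_Mapping.single a 1"
  using assms by (auto simp: is_monomial_def X_power prod_single_one)

lemma act_inv_Sym:
  assumes "\<sigma> \<in> carrier (Sym n)"
  shows "act (inv\<^bsub>Sym n\<^esub> \<sigma>) (act \<sigma> F) = F" "act \<sigma> (act (inv\<^bsub>Sym n\<^esub> \<sigma>) F) = F"
  using assms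
  by (simp_all flip: act_act[where n = n]
      add: group.r_inv[OF group_Sym] group.l_inv[OF group_Sym] act_one_Sym)

lemma finite_carrier_Sym: "finite (carrier (Sym n))"
  by (simp add: Sym_def sym_group_def finite_permutations)

text \<open>Acting by an element of \<open>H\<close> permutes the orbit, so it only reorders the
  summands.\<close>

lemma invariant_orbit_sum:
  assumes "subgroup H (Sym n)"
  shows "invariant H (orbit_sum H F)"
  unfolding invariant_def
proof
  fix h assume h: "h \<in> H"
  interpret group "Sym n" by (rule group_Sym)
  interpret H: subgroup H "Sym n" by fact
  let ?O = "{act k F |k. k \<in> H}"
  have mem: "act k p \<in> ?O" if "k \<in> H" "p \<in> ?O" for k p
    using that by (auto simp flip: act_act[where n = n])
  \<comment> \<open>The inverse of \<open>h\<close> is again in \<open>H\<close>, hence it also maps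
    the orbit into itself and undoes \<open>act h\<close>.\<close>
  have "bij_betw (act h) ?O ?O"
    using h mem by (intro bij_betw_byWitness[where f' = "act (inv\<^bsub>Sym n\<^esub> h)"])
      (auto simp: act_inv_Sym)
  then have "(\<Sum>p\<in>?O. act h p) = (\<Sum>p\<in>?O. p)"
    by (rule sum.reindex_bij_betw)
  then show "act h (orbit_sum H F) = orbit_sum H F"
    by (simp add: orbit_sum_def act_sum)
qed

lemma subgroup_Stab:
  assumes "subgroup G (Sym n)"
  shows "subgroup (Stab G F) (Sym n)"
proof -
  interpret group "Sym n" by (rule group_Sym)
  interpret G: subgroup G "Sym n" by fact
  have "act (inv\<^bsub>Sym n\<^esub> \<sigma>) F = F" if "\<sigma> \<in> G" "act \<sigma> F = F" for \<sigma>
    using act_inv_Sym(1)[of \<sigma> n F] that by simp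
  then show ?thesis
    by (intro subgroupI)
      (auto simp: Stab_def act_act act_one_Sym intro!: exI[of _ "\<one>\<^bsub>Sym n\<^esub>"])
qed

lemma mem_double_coset_iff:
  "x \<in> double_coset K S g H \<longleftrightarrow> (\<exists>s\<in>S. \<exists>h\<in>H. x = s \<otimes>\<^bsub>K\<^esub> g \<otimes>\<^bsub>K\<^esub> h)"
  by (auto simp: double_coset_def r_coset_def set_mult_def)

context group
begin

lemma double_coset_subset:
  assumes "subgroup S G" "subgroup H G" "g \<in> carrier G" "g' \<in> double_coset G S g H"
  shows "double_coset G S g' H \<subseteq> double_coset G S g H"
proof
  interpret S: subgroup S G by fact
  interpret H: subgroup H G by fact
  obtain s h where sh: "s \<in> S" "h \<in> H" "g' = s \<otimes> g \<otimes> h"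
    using assms(4) by (auto simp: mem_double_coset_iff)
  fix x assume "x \<in> double_coset G S g' H"
  then obtain t u where tu: "t \<in> S" "u \<in> H" "x = t \<otimes> g' \<otimes> u"
    by (auto simp: mem_double_coset_iff)
  \<comment> \<open>The extra factors are absorbed by the subgroups on the two sides.\<close>
  have "x = (t \<otimes> s) \<otimes> g \<otimes> (h \<otimes> u)"
    using sh tu assms(3) by (simp add: m_assoc)
  then show "x \<in> double_coset G S g H"
    using sh tu by (auto simp: mem_double_coset_iff)
qed

text \<open>Solving \<open>g' = s \<otimes> g \<otimes> h\<close> for \<open>g\<close> shows that
  membership is symmetric, so the inclusion of \<open>double_coset_subset\<close> holds in both
  directions.\<close>

lemma double_coset_eqI:
  assumes S: "subgroup S G" and H: "subgroup H G" and g: "g \<in> carrier G"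
    and g': "g' \<in> double_coset G S g H"
  shows "double_coset G S g' H = double_coset G S g H"
proof -
  interpret S: subgroup S G by fact
  interpret H: subgroup H G by fact
  obtain s h where sh: "s \<in> S" "h \<in> H" "g' = s \<otimes> g \<otimes> h"
    using g' by (auto simp: mem_double_coset_iff)
  then have "g = inv s \<otimes> g' \<otimes> inv h"
    using g by (simp add: m_assoc inv_solve_left)
  then have "g \<in> double_coset G S g' H"
    using sh by (auto simp: mem_double_coset_iff)
  moreover have "g' \<in> carrier G"
    using sh g by simp
  ultimately show ?thesis
    using double_coset_subset[OF S H] g g' by blast
qed

end

text \<open>Distinct members of the orbit have distinct exponents, so at most one contributes at
  \<open>b\<close>. The orbit is a set, so a monomial reached by several \<open>h\<close> still
  counts once.\<close>

lemma lookup_orbit_sum_single: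
  assumes "finite H"
  shows "Poly_Mapping.lookup (orbit_sum H (Poly_Mapping.single a (1 :: 'a::comm_semiring_1))) b =
    (if \<exists>h\<in>H. Poly_Mapping.single b 1 = act h (Poly_Mapping.single a (1 :: 'a)) then 1 else 0)"
proof -
  let ?O = "{act h (Poly_Mapping.single a (1 :: 'a)) |h. h \<in> H}"
  \<comment> \<open>This rules out the default value 0 of a sum over an infinite set.\<close>
  have fin: "finite ?O"
    using assms by simp
  have "Poly_Mapping.lookup p b = (if p = Poly_Mapping.single b 1 then 1 else 0)"
    if "p \<in> ?O" for p
  proof -
    obtain c where "p = Poly_Mapping.single c 1"
      using \<open>p \<in> ?O\<close> act_single_one by blast
    then show ?thesis
      by (metis lookup_single_eq lookup_single_not_eq)
  qed
  then have "Poly_Mapping.lookup (\<Sum>p\<in>?O. p) b =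
      (\<Sum>p\<in>?O. if p = Poly_Mapping.single b 1 then 1 else 0)"
    by (simp add: lookup_sum)
  also have "\<dots> = (if Poly_Mapping.single b 1 \<in> ?O then 1 else 0)"
    using fin by (rule sum.delta)
  finally show ?thesis
    unfolding orbit_sum_def by (simp add: Bex_def conj_commute)
qed

lemma lookup_scale_mpoly:
  "Poly_Mapping.lookup (scale_mpoly c p) a = c * Poly_Mapping.lookup p a"
  by (simp add: map.rep_eq when_def)

lemma lookup_to_rat_mpoly:
  "Poly_Mapping.lookup (to_rat_mpoly p) a = rat_of_int (Poly_Mapping.lookup p a)"
  by (simp add: map.rep_eq when_def)

text \<open>Taking the coefficient at \<open>a i\<close> is a linear functional that picks out
  \<open>p i\<close>. Injectivity is stated separately because independence of the image set alone
  would not exclude repetitions in the family.\<close>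

lemma independent_if_dual_coefficients:
  assumes "finite I"
    and coeff: "\<And>i j. i \<in> I \<Longrightarrow> j \<in> I \<Longrightarrow>
      Poly_Mapping.lookup (p j) (a i) = (if i = j then 1 else 0 :: rat)"
  shows "inj_on p I" "rat_mpoly.independent (p ` I)"
proof -
  show inj: "inj_on p I"
    by (rule inj_onI) (metis coeff zero_neq_one)
  show "rat_mpoly.independent (p ` I)"
  proof (rule rat_mpoly.independent_if_scalars_zero)
    show "finite (p ` I)" using assms(1) by simp
    fix f x assume sum0: "(\<Sum>x\<in>p ` I. scale_mpoly (f x) x) = 0" and "x \<in> p ` I"
    then obtain i where i: "i \<in> I" "x = p i" by auto
    \<comment> \<open>Compare the coefficients at \<open>a i\<close> in the vanishing combination;
      injectivity turns the sum over the image into one over \<open>I\<close>.\<close>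
    have "0 = (\<Sum>j\<in>I. f (p j) * Poly_Mapping.lookup (p j) (a i))"
      using arg_cong[OF sum0, of "\<lambda>q. Poly_Mapping.lookup q (a i)"]
      by (simp add: sum.reindex[OF inj] lookup_sum lookup_scale_mpoly)
    also have "\<dots> = (\<Sum>j\<in>I. if j = i then f (p j) else 0)"
      using i coeff by (intro sum.cong) auto
    also have "\<dots> = f x"
      using assms(1) i by simp
    finally show "f x = 0" by simp
  qed
qed

lemma double_coset_Stab_eqI:
  assumes G: "subgroup G (Sym n)" and H: "subgroup H (Sym n)" and HG: "H \<subseteq> G"
    and \<sigma>: "\<sigma> \<in> G" and \<tau>: "\<tau> \<in> G" and h: "h \<in> H"
    and eq: "act \<sigma> F = act h (act \<tau> F)"
  shows "double_coset (Sym n) (Stab G F) \<sigma> H = double_coset (Sym n) (Stab G F) \<tau> H"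
proof -
  interpret group "Sym n" by (rule group_Sym)
  interpret G: subgroup G "Sym n" by fact
  have hG: "h \<in> G" using h HG by blast
  \<comment> \<open>By \<open>eq\<close>, \<open>\<sigma>\<close> and the product of
    \<open>\<tau>\<close> and \<open>h\<close> send \<open>F\<close> to the same polynomial, so
    their quotient \<open>\<rho>\<close> stabilises \<open>F\<close>.\<close>
  define \<rho> where "\<rho> = \<sigma> \<otimes>\<^bsub>Sym n\<^esub> inv\<^bsub>Sym n\<^esub> (\<tau> \<otimes>\<^bsub>Sym n\<^esub> h)"
  have "act \<rho> F = act (inv\<^bsub>Sym n\<^esub> (\<tau> \<otimes>\<^bsub>Sym n\<^esub> h)) (act (\<tau> \<otimes>\<^bsub>Sym n\<^esub> h) F)"
    by (simp add: \<rho>_def act_act eq)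
  also have "\<dots> = F"
    using \<tau> hG by (intro act_inv_Sym) simp
  finally have "\<rho> \<in> Stab G F"
    using \<sigma> \<tau> hG by (simp add: Stab_def \<rho>_def)
  moreover have "\<sigma> = \<rho> \<otimes>\<^bsub>Sym n\<^esub> \<tau> \<otimes>\<^bsub>Sym n\<^esub> h"
    using \<sigma> \<tau> hG by (simp add: \<rho>_def m_assoc inv_mult_group)
  ultimately have "\<sigma> \<in> double_coset (Sym n) (Stab G F) \<tau> H"
    using h by (auto simp: mem_double_coset_iff)
  then show ?thesis
    using subgroup_Stab[OF G] H \<tau> by (intro double_coset_eqI) auto
qed

theorem theorem4p5:
  fixes n r :: nat
    and G H :: "(nat \<Rightarrow> nat) set"
    and m :: "int mpoly"
    and g :: "nat \<Rightarrow> (nat \<Rightarrow> nat)"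
  assumes "subgroup G (Sym n)"
    and "subgroup H (Sym n)" and "H \<subseteq> G"
    and "is_monomial n m"
    and "\<And>i. i \<in> {1..r} \<Longrightarrow> g i \<in> G"
    and "G = (\<Union>i\<in>{1..r}. double_coset (Sym n) (Stab G m) (g i) H)"
    and "\<And>i j. i \<in> {1..r} \<Longrightarrow> j \<in> {1..r} \<Longrightarrow>
      double_coset (Sym n) (Stab G m) (g i) H = double_coset (Sym n) (Stab G m) (g j) H \<longleftrightarrow> i = j"
  shows "(\<forall>i\<in>{1..r}. invariant H (orbit_sum H (act (g i) m))) \<and>
    inj_on (\<lambda>i. to_rat_mpoly (orbit_sum H (act (g i) m))) {1..r} \<and>
    rat_mpoly.independent ((\<lambda>i. to_rat_mpoly (orbit_sum H (act (g i) m))) ` {1..r})"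
proof -
  interpret H: subgroup H "Sym n" by fact
  have finH: "finite H"
    using H.subset finite_carrier_Sym by (rule finite_subset)
  have "\<exists>b. act (g i) m = Poly_Mapping.single b 1" for i
    using is_monomialD[OF assms(4)] act_single_one by blast
  then obtain a where a: "act (g i) m = Poly_Mapping.single (a i) 1" for i
    by metis
  have "Poly_Mapping.lookup (to_rat_mpoly (orbit_sum H (act (g j) m))) (a i) =
      (if i = j then 1 else 0)" if ij: "i \<in> {1..r}" "j \<in> {1..r}" for i j
  proof -
    \<comment> \<open>The left side is the condition in \<open>lookup_orbit_sum_single\<close> for
      the exponent \<open>a i\<close> and the orbit of \<open>act (g j) m\<close>.\<close>
    have "(\<exists>h\<in>H. act (g i) m = act h (act (g j) m)) \<longleftrightarrow> i = j"
    proof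
      assume "\<exists>h\<in>H. act (g i) m = act h (act (g j) m)"
      then show "i = j"
        using assms(7)[OF ij] double_coset_Stab_eqI[OF assms(1-3) assms(5,5), OF ij] by blast
    next
      assume "i = j"
      then show "\<exists>h\<in>H. act (g i) m = act h (act (g j) m)"
        using H.one_closed act_one_Sym by metis
    qed
    then show ?thesis
      by (simp add: lookup_to_rat_mpoly lookup_orbit_sum_single[OF finH] a)
  qed
  from independent_if_dual_coefficients[OF finite_atLeastAtMost this] invariant_orbit_sum[OF assms(2)]
  show ?thesis by blast
qed

end
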